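(* Let $k\geq2$ be an integer. The decision problem "Given a $k$-regular sequence $(f(n))_{n\geq0}$, does $(f(n))_{n\geq0}$ contain a nontrivial palindrome?" is recursively unsolvable.
   Context: For $n\in\mathbb{N}_0$, $(n)_k=n_{s-1}\cdots n_0$ is the standard base-$k$ representation of $n$ (no leading zeros; $(0)_k$ empty). A sequence $(f(n))_{n\geq0}$ is $k$-regular if there exist $r\geq0$, a $1\times r$ row vector $v$, an $r\times1$ column vector $w$ and $r\times r$ matrices $M_0,\dots,M_{k-1}$ such that $f(n)=vM_{n_0}\cdots M_{n_{s-1}}w$ for all $n$; the input is such a linear representation. A palindrome in $(f(n))$ is a nonempty contiguous block $(f(j))_{i\leq j<i+L}$ that reads the same forwards and backwards, i.e., $f(i+t)=f(i+L-1-t)$ for $0\leq t<L$; it is nontrivial if $L\geq2$. *)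

theory Defs
  imports Main "HOL-Library.Nat_Bijection"
begin

text \<open>recfn n f: f, viewed on argument lists of length n, is a total recursive
function of n arguments. Built from zero, successor, projections by
composition, primitive recursion and regular (total) minimisation.\<close>

definition prim_rec_fun ::
  "(nat list \<Rightarrow> nat) \<Rightarrow> (nat list \<Rightarrow> nat) \<Rightarrow> nat list \<Rightarrow> nat" where
  "prim_rec_fun f g xs =
     (case xs of [] \<Rightarrow> 0
      | y # ys \<Rightarrow> rec_nat (f ys) (\<lambda>z acc. g (z # acc # ys)) y)"

inductive recfn :: "nat \<Rightarrow> (nat list \<Rightarrow> nat) \<Rightarrow> bool" where
  rf_zero: "recfn n (\<lambda>xs. 0)"
| rf_succ: "recfn 1 (\<lambda>xs. Suc (hd xs))"
| rf_proj: "i < n \<Longrightarrow> recfn n (\<lambda>xs. xs ! i)"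
| rf_comp: "recfn m f \<Longrightarrow> length gs = m \<Longrightarrow> (\<forall>j<m. recfn n (gs ! j)) \<Longrightarrow>
            recfn n (\<lambda>xs. f (map (\<lambda>g. g xs) gs))"
| rf_prec: "recfn n f \<Longrightarrow> recfn (Suc (Suc n)) g \<Longrightarrow>
            recfn (Suc n) (prim_rec_fun f g)"
| rf_min: "recfn (Suc n) g \<Longrightarrow> (\<forall>xs. length xs = n \<longrightarrow> (\<exists>y. g (y # xs) = 0)) \<Longrightarrow>
           recfn n (\<lambda>xs. LEAST y. g (y # xs) = 0)"

text \<open>A linear representation is a triple (v, w, Ms): row vector v, column
vector w (both of length r) and the list Ms of the k matrices M_0..M_{k-1},
each r x r, given as a list of rows.\<close>

type_synonym linrep = "int list \<times> int list \<times> int list list list"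

definition valid_linrep :: "nat \<Rightarrow> linrep \<Rightarrow> bool" where
  "valid_linrep k R = (case R of (v, w, Ms) \<Rightarrow>
      length w = length v \<and> length Ms = k \<and>
      (\<forall>M\<in>set Ms. length M = length v \<and> (\<forall>row\<in>set M. length row = length v)))"

fun digits :: "nat \<Rightarrow> nat \<Rightarrow> nat list" where
  "digits k n = (if k < 2 \<or> n = 0 then [] else n mod k # digits k (n div k))"

definition dotp :: "int list \<Rightarrow> int list \<Rightarrow> int" where
  "dotp xs ys = sum_list (map2 (*) xs ys)"

definition vecmat :: "int list \<Rightarrow> int list list \<Rightarrow> int list" where
  "vecmat x M = map (\<lambda>j. \<Sum>i<length M. x ! i * (M ! i) ! j) [0..<length x]"

definition linrep_seq :: "nat \<Rightarrow> linrep \<Rightarrow> nat \<Rightarrow> int" where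
  "linrep_seq k R n = (case R of (v, w, Ms) \<Rightarrow>
      dotp (foldl (\<lambda>x d. vecmat x (Ms ! d)) v (digits k n)) w)"

definition has_nontrivial_palindrome :: "(nat \<Rightarrow> int) \<Rightarrow> bool" where
  "has_nontrivial_palindrome f =
     (\<exists>i L. 2 \<le> L \<and> (\<forall>t<L. f (i + t) = f (i + L - 1 - t)))"

definition enc_ints :: "int list \<Rightarrow> nat" where
  "enc_ints xs = list_encode (map int_encode xs)"

definition enc_linrep :: "linrep \<Rightarrow> nat" where
  "enc_linrep R = (case R of (v, w, Ms) \<Rightarrow>
      prod_encode (enc_ints v,
        prod_encode (enc_ints w,
          list_encode (map (\<lambda>M. list_encode (map enc_ints M)) Ms))))"

end

theory Submission
  imports Defs
begin

text \<open>A palindrome in the partial sums of a nonnegative sequence \<^term>\<open>g\<close> exists iff \<^term>\<open>g\<close> has a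
  zero: a palindrome forces equal partial sums at its two ends, and a zero gives two equal
  neighbours. Take for \<^term>\<open>g n\<close> the sum of the squared violations incurred when the digits of
  \<^term>\<open>n\<close> are read as a run of a nondeterministic register program. All updates and tests being linear
  in the registers, this is a quadratic form in the input whose coefficients are regular sequences
  of \<^term>\<open>n\<close>, and it has a zero iff the program has an accepting run. Every recursive function is
  computed by such a program, so its zero set reduces to palindromes.

  No universal function is needed. The input \<open>(x, y)\<close> enters only the initial row vector, through
  the products of two of the numbers \<open>1, x, y\<close>, while the rest of the representation depends on the
  function alone. So a decision procedure would yield a recursive function of \<open>(x, y)\<close> which builds
  the code of the whole representation from codes \<open>x, y\<close> of its remaining parts and decides it;
  feeding the representation that belongs to this function with its own codes is contradictory.\<close>

section \<open>Nondeterministic register programs\<close>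

type_synonym state = "nat \<Rightarrow> nat"
text \<open>Bit strings allow disjoint copies of label sets to be made by prefixing a bit.\<close>

type_synonym label = "bool list"

text \<open>Both instructions are homogeneous linear in the registers, so a failed test can be
  charged as the square of a linear form. Branching is left to nondeterminism, and constants come
  from register 0.\<close>

datatype instr = Assign nat nat nat nat nat | Test nat nat

fun exec :: "instr \<Rightarrow> state \<Rightarrow> state" where
  "exec (Assign c x a y b) s = s(c := x * s a + y * s b)"
| "exec (Test a b) s = s"

fun guard :: "instr \<Rightarrow> state \<Rightarrow> bool" where
  "guard (Assign c x a y b) s = True"
| "guard (Test a b) s = (s a = s b)"

text \<open>Register 0 has to keep the value 1 during the whole run.\<close>

fun writable :: "instr \<Rightarrow> bool" where
  "writable (Assign c x a y b) = (c \<noteq> 0)"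
| "writable (Test a b) = True"

type_synonym edge = "label \<times> instr \<times> label"

definition step :: "edge set \<Rightarrow> ((label \<times> state) \<times> (label \<times> state)) set" where
  "step E = {((p, s), (q, exec I s)) | p s q I. (p, I, q) \<in> E \<and> guard I s}"

definition path_rel :: "edge set \<Rightarrow> label \<Rightarrow> label \<Rightarrow> (state \<times> state) set" where
  "path_rel E p q = {(s, s'). ((p, s), (q, s')) \<in> (step E)\<^sup>*}"

text \<open>A run may pass through \<open>q\<close> and go on before it finally stops there.
  Nonemptiness of \<open>E\<close> makes a cyclic enumeration of the edges possible.\<close>

definition programmable :: "(state \<times> state) set \<Rightarrow> bool" where
  "programmable R \<longleftrightarrow> (\<exists>E p q. finite E \<and> E \<noteq> {} \<and> (\<forall>(p, I, q)\<in>E. writable I) \<and> R = path_rel E p q)"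

definition instr_rel :: "instr \<Rightarrow> (state \<times> state) set" where
  "instr_rel I = {(s, exec I s) | s. guard I s}"

definition tag :: "bool \<Rightarrow> edge set \<Rightarrow> edge set" where
  "tag b E = (\<lambda>(p, I, q). (b # p, I, b # q)) ` E"

section \<open>Runs of programs, composition and iteration\<close>

lemma stepI: "(p, I, q) \<in> E \<Longrightarrow> guard I s \<Longrightarrow> s' = exec I s \<Longrightarrow> ((p, s), (q, s')) \<in> step E"
  unfolding step_def by blast

lemma stepE:
  assumes "((p, s), (q, s')) \<in> step E"
  obtains I where "(p, I, q) \<in> E" "guard I s" "s' = exec I s"
  using assms unfolding step_def by blast

lemma steps_mono: "E \<subseteq> F \<Longrightarrow> x \<in> (step E)\<^sup>* \<Longrightarrow> x \<in> (step F)\<^sup>*"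
proof -
  assume "E \<subseteq> F" "x \<in> (step E)\<^sup>*"
  moreover have "step E \<subseteq> step F" using \<open>E \<subseteq> F\<close> unfolding step_def by blast
  ultimately show ?thesis using rtrancl_mono by blast
qed

lemma steps_tag: "((p, s), (q, s')) \<in> (step E)\<^sup>* \<Longrightarrow> ((b # p, s), (b # q, s')) \<in> (step (tag b E))\<^sup>*"
proof (induction rule: rtrancl_induct2)
  case (step p t q u)
  from step(2) obtain I where "(p, I, q) \<in> E" "guard I t" "u = exec I t" by (rule stepE)
  then have "((b # p, t), (b # q, u)) \<in> step (tag b E)"
    by (intro stepI[of _ I]) (force simp: tag_def)+
  with step show ?case by (meson rtrancl.rtrancl_into_rtrancl)
qed simp

lemma tag_edge: "(p, I, q) \<in> tag b E \<longleftrightarrow> (\<exists>p' q'. p = b # p' \<and> q = b # q' \<and> (p', I, q') \<in> E)"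
  unfolding tag_def by force

lemma finite_tag: "finite E \<Longrightarrow> finite (tag b E)"
  unfolding tag_def by simp

lemma programmable_instr:
  assumes "writable I"
  shows "programmable (instr_rel I)"
proof -
  let ?E = "{([], I, [True])} :: edge set"
  have *: "case y of (q, t) \<Rightarrow> (q = [] \<and> t = s) \<or> (q = [True] \<and> guard I s \<and> t = exec I s)"
    if "(([], s), y) \<in> (step ?E)\<^sup>*" for s y
    using that by (induction rule: rtrancl_induct) (auto elim!: stepE)
  have "(([], s), ([True], exec I s)) \<in> (step ?E)\<^sup>*" if "guard I s" for s
    using that by (intro r_into_rtrancl stepI[of _ I]) auto
  moreover have "guard I s \<and> t = exec I s" if "(([], s), ([True], t)) \<in> (step ?E)\<^sup>*" for s t
    using *[OF that] by simp
  ultimately have "instr_rel I = path_rel ?E [] [True]"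
    unfolding instr_rel_def path_rel_def by blast
  then show ?thesis unfolding programmable_def using assms by (intro exI[of _ ?E]) auto
qed

text \<open>Disjoint copies of the two programs are joined by one edge with the vacuous test
  \<open>Test 0 0\<close>. No edge leads back, so every run from start to end crosses it exactly
  once.\<close>

lemma programmable_comp:
  assumes "programmable R" "programmable S"
  shows "programmable (R O S)"
proof -
  obtain E p q where E: "finite E" "\<forall>(p, I, q)\<in>E. writable I" "R = path_rel E p q"
    using assms(1) unfolding programmable_def by blast
  obtain F p' q' where F: "finite F" "\<forall>(p, I, q)\<in>F. writable I" "S = path_rel F p' q'"
    using assms(2) unfolding programmable_def by blast
  let ?L = "(True # q, Test 0 0, False # p')"
  let ?G = "insert ?L (tag True E \<union> tag False F)"
  have inv: "case y of (l, u) \<Rightarrow> (\<exists>l'. l = True # l' \<and> ((p, s), (l', u)) \<in> (step E)\<^sup>*) \<or>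
      (\<exists>l' t. l = False # l' \<and> (s, t) \<in> R \<and> ((p', t), (l', u)) \<in> (step F)\<^sup>*)"
    if "((True # p, s), y) \<in> (step ?G)\<^sup>*" for s y
    using that
  proof (induction rule: rtrancl_induct)
    case (step y z)
    obtain l u l' u' where yz: "y = (l, u)" "z = (l', u')" by fastforce
    obtain I where I: "(l, I, l') \<in> ?G" "guard I u" "u' = exec I u"
      using step(2) unfolding yz by (rule stepE)
    from I(1) consider "(l, I, l') = ?L" | "(l, I, l') \<in> tag True E" | "(l, I, l') \<in> tag False F"
      by blast
    then show ?case
    proof cases
      case 1
      then show ?thesis using step(3) I unfolding yz E(3) path_rel_def by auto
    next
      case 2
      then obtain a b where "l = True # a" "l' = True # b" "(a, I, b) \<in> E" unfolding tag_edge by blast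
      then show ?thesis using step(3) I stepI[of a I b E u u'] unfolding yz
        by (auto intro: rtrancl_into_rtrancl)
    next
      case 3
      then obtain a b where "l = False # a" "l' = False # b" "(a, I, b) \<in> F" unfolding tag_edge by blast
      then show ?thesis using step(3) I stepI[of a I b F u u'] unfolding yz
        by (auto intro: rtrancl_into_rtrancl)
    qed
  qed simp
  have "R O S = path_rel ?G (True # p) (False # q')"
  proof (intro equalityI subrelI)
    fix s u assume "(s, u) \<in> R O S"
    then obtain t where t: "((p, s), (q, t)) \<in> (step E)\<^sup>*" "((p', t), (q', u)) \<in> (step F)\<^sup>*"
      unfolding E(3) F(3) path_rel_def by blast
    have "((True # p, s), (True # q, t)) \<in> (step ?G)\<^sup>*"
      using steps_tag[OF t(1)] by (rule steps_mono[rotated]) auto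
    also have "((True # q, t), (False # p', t)) \<in> step ?G" by (rule stepI) auto
    also have "((False # p', t), (False # q', u)) \<in> (step ?G)\<^sup>*"
      using steps_tag[OF t(2)] by (rule steps_mono[rotated]) auto
    finally show "(s, u) \<in> path_rel ?G (True # p) (False # q')" unfolding path_rel_def by simp
  next
    fix s u assume "(s, u) \<in> path_rel ?G (True # p) (False # q')"
    then have "((True # p, s), (False # q', u)) \<in> (step ?G)\<^sup>*" unfolding path_rel_def by simp
    from inv[OF this] show "(s, u) \<in> R O S" unfolding F(3) path_rel_def by auto
  qed
  moreover have "\<forall>(p, I, q)\<in>?G. writable I" using E(2) F(2) by (fastforce simp: tag_edge)
  ultimately show ?thesis unfolding programmable_def using E(1) F(1) finite_tag
    by (intro exI[of _ ?G]) blast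
qed

text \<open>The empty label differs from all tagged labels. It serves as start and end, and vacuous
  tests lead from it into the copy of the program and back from the end of that copy.\<close>

lemma programmable_star:
  assumes "programmable R"
  shows "programmable (R\<^sup>*)"
proof -
  obtain E p q where E: "finite E" "\<forall>(p, I, q)\<in>E. writable I" "R = path_rel E p q"
    using assms(1) unfolding programmable_def by blast
  let ?L = "([], Test 0 0, True # p)" and ?M = "(True # q, Test 0 0, [])"
  let ?G = "insert ?L (insert ?M (tag True E))"
  have inv: "case y of (l, u) \<Rightarrow> (l = [] \<and> (s, u) \<in> R\<^sup>*) \<or>
      (\<exists>l' t. l = True # l' \<and> (s, t) \<in> R\<^sup>* \<and> ((p, t), (l', u)) \<in> (step E)\<^sup>*)"
    if "(([], s), y) \<in> (step ?G)\<^sup>*" for s y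
    using that
  proof (induction rule: rtrancl_induct)
    case (step y z)
    obtain l u l' u' where yz: "y = (l, u)" "z = (l', u')" by fastforce
    obtain I where I: "(l, I, l') \<in> ?G" "guard I u" "u' = exec I u"
      using step(2) unfolding yz by (rule stepE)
    from I(1) consider "(l, I, l') = ?L" | "(l, I, l') = ?M" | "(l, I, l') \<in> tag True E"
      by blast
    then show ?case
    proof cases
      case 1
      then show ?thesis using step(3) I unfolding yz by auto
    next
      case 2
      then obtain t where "(s, t) \<in> R\<^sup>*" "((p, t), (q, u)) \<in> (step E)\<^sup>*"
        using step(3) unfolding yz by auto
      then have "(s, u) \<in> R\<^sup>*" unfolding E(3) path_rel_def by (auto intro: rtrancl_into_rtrancl)
      then show ?thesis using 2 I unfolding yz by auto
    next
      case 3
      then obtain a b where "l = True # a" "l' = True # b" "(a, I, b) \<in> E" unfolding tag_edge by blast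
      then show ?thesis using step(3) I stepI[of a I b E u u'] unfolding yz
        by (auto intro: rtrancl_into_rtrancl)
    qed
  qed simp
  have "R\<^sup>* = path_rel ?G [] []"
  proof (intro equalityI subrelI)
    fix s u assume "(s, u) \<in> R\<^sup>*"
    then show "(s, u) \<in> path_rel ?G [] []"
    proof (induction rule: rtrancl_induct)
      case (step t u)
      then have t: "(([], s), ([], t)) \<in> (step ?G)\<^sup>*" "((p, t), (q, u)) \<in> (step E)\<^sup>*"
        unfolding E(3) path_rel_def by auto
      note t(1)
      also have "(([], t), (True # p, t)) \<in> step ?G" by (rule stepI) auto
      also have "((True # p, t), (True # q, u)) \<in> (step ?G)\<^sup>*"
        using steps_tag[OF t(2)] by (rule steps_mono[rotated]) auto
      also have "((True # q, u), ([], u)) \<in> step ?G" by (rule stepI) auto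
      finally show ?case unfolding path_rel_def by simp
    qed (simp add: path_rel_def)
  next
    fix s u assume "(s, u) \<in> path_rel ?G [] []"
    then have "(([], s), ([], u)) \<in> (step ?G)\<^sup>*" unfolding path_rel_def by simp
    from inv[OF this] show "(s, u) \<in> R\<^sup>*" by simp
  qed
  moreover have "\<forall>(p, I, q)\<in>?G. writable I" using E(2) by (fastforce simp: tag_edge)
  ultimately show ?thesis unfolding programmable_def using E(1) finite_tag
    by (intro exI[of _ ?G]) blast
qed

text \<open>Stuck and infinite runs are disregarded: a wrong guess merely fails to reach the end
  label. What counts is that some run ends and that all runs that end agree with
  \<open>Q\<close>.\<close>

definition ensures :: "(state \<times> state) set \<Rightarrow> state \<Rightarrow> (state \<Rightarrow> bool) \<Rightarrow> bool" where
  "ensures R s Q \<longleftrightarrow> (\<exists>s'. (s, s') \<in> R) \<and> (\<forall>s'. (s, s') \<in> R \<longrightarrow> Q s')"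

lemma ensures_comp:
  assumes "ensures R s P" "\<And>t. P t \<Longrightarrow> ensures S t Q"
  shows "ensures (R O S) s Q"
  using assms unfolding ensures_def by blast

lemma ensures_weaken: "ensures R s P \<Longrightarrow> (\<And>t. P t \<Longrightarrow> Q t) \<Longrightarrow> ensures R s Q"
  unfolding ensures_def by blast

lemma ensures_instr: "guard I s \<Longrightarrow> Q (exec I s) \<Longrightarrow> ensures (instr_rel I) s Q"
  unfolding ensures_def instr_rel_def by blast

lemma ensures_instr_comp: "guard I s \<Longrightarrow> ensures S (exec I s) Q \<Longrightarrow> ensures (instr_rel I O S) s Q"
  unfolding ensures_def instr_rel_def by blast

text \<open>\<open>R\<^sup>*\<close> may be left after any number of rounds, so the invariant is
  indexed by that number. Existence of a run needs progress only up to round \<open>N\<close>;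
  correctness must come from the tests in \<open>S\<close>, whichever round is the last.\<close>

lemma ensures_loop:
  assumes init: "I 0 s"
    and step: "\<And>n t t'. I n t \<Longrightarrow> (t, t') \<in> R \<Longrightarrow> I (Suc n) t'"
    and progress: "\<And>n t. n < N \<Longrightarrow> I n t \<Longrightarrow> \<exists>t'. (t, t') \<in> R"
    and exits: "\<And>t. I N t \<Longrightarrow> \<exists>t'. (t, t') \<in> S"
    and post: "\<And>n t t'. I n t \<Longrightarrow> (t, t') \<in> S \<Longrightarrow> Q t'"
  shows "ensures (R\<^sup>* O S) s Q"
proof -
  have inv: "\<exists>n. I n t" if "(s, t) \<in> R\<^sup>*" for t
    using that by (induction rule: rtrancl_induct) (use init step in blast)+
  have "\<exists>t. (s, t) \<in> R\<^sup>* \<and> I n t" if "n \<le> N" for n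
    using that
  proof (induction n)
    case (Suc n)
    then obtain t where t: "(s, t) \<in> R\<^sup>*" "I n t" by auto
    with progress Suc.prems obtain t' where "(t, t') \<in> R" by (meson Suc_le_lessD)
    with t step show ?case by (meson rtrancl.rtrancl_into_rtrancl)
  qed (use init in blast)
  then obtain t where "(s, t) \<in> R\<^sup>*" "I N t" by blast
  with exits inv post show ?thesis unfolding ensures_def by blast
qed

section \<open>Compilation of recursive functions into programs\<close>

definition same_except :: "nat \<Rightarrow> nat \<Rightarrow> state \<Rightarrow> state \<Rightarrow> bool" where
  "same_except B r s s' \<longleftrightarrow> (\<forall>i<B. i \<noteq> r \<longrightarrow> s' i = s i)"

text \<open>Register 0 is a constant 1, and registers from \<^term>\<open>B\<close> on are scratch space.\<close>

definition computable :: "nat \<Rightarrow> (nat list \<Rightarrow> nat) \<Rightarrow> bool" where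
  "computable n f \<longleftrightarrow> (\<forall>args r B. length args = n \<longrightarrow> (\<forall>a\<in>set args. a < B) \<longrightarrow> 0 < r \<longrightarrow> r < B \<longrightarrow>
     (\<exists>R. programmable R \<and> (\<forall>s. s 0 = 1 \<longrightarrow>
        ensures R s (\<lambda>s'. s' r = f (map s args) \<and> same_except B r s s'))))"

lemma computableE:
  assumes "computable n f" "length args = n" "\<And>a. a \<in> set args \<Longrightarrow> a < B" "0 < r" "r < B"
  obtains R where "programmable R"
    "\<And>s. s 0 = 1 \<Longrightarrow> ensures R s (\<lambda>s'. s' r = f (map s args) \<and> same_except B r s s')"
  using assms unfolding computable_def by blast

lemma computable_single:
  assumes "\<And>args. length args = n \<Longrightarrow>
    \<exists>x a y b. \<forall>s::state. s 0 = 1 \<longrightarrow> x * s a + y * s b = f (map s args)"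
  shows "computable n f"
  unfolding computable_def
proof (intro allI impI)
  fix args :: "nat list" and r B assume a: "length args = n" "0 < r" "r < (B::nat)"
  then obtain x a y b where *: "\<forall>s::state. s 0 = 1 \<longrightarrow> x * s a + y * s b = f (map s args)"
    using assms[OF a(1)] by blast
  show "\<exists>R. programmable R \<and> (\<forall>s. s 0 = 1 \<longrightarrow>
        ensures R s (\<lambda>s'. s' r = f (map s args) \<and> same_except B r s s'))"
    using a * by (intro exI[of _ "instr_rel (Assign r x a y b)"])
      (auto intro!: programmable_instr ensures_instr simp: same_except_def)
qed

text \<open>The value of the \<open>j\<close>-th inner function goes to register
  \<open>B + j\<close>. Raising the scratch bound to \<open>B + Suc j\<close> for its computation
  protects the input and the earlier values.\<close>

lemma computable_comp:
  assumes f: "computable m f" and gs: "length gs = m" "\<forall>j<m. computable n (gs ! j)"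
  shows "computable n (\<lambda>xs. f (map (\<lambda>g. g xs) gs))"
  unfolding computable_def
proof (intro allI impI)
  fix args :: "nat list" and r B
  assume args: "length args = n" "\<forall>a\<in>set args. a < B" and r: "0 < r" "r < (B::nat)"
  have "\<exists>R. programmable R \<and> (\<forall>s. s 0 = 1 \<longrightarrow>
      ensures R s (\<lambda>s'. (\<forall>i<j. s' (B + i) = (gs ! i) (map s args)) \<and> (\<forall>i<B. s' i = s i)))"
    if "j \<le> m" for j
    using that
  proof (induction j)
    case 0
    show ?case by (intro exI[of _ "instr_rel (Test 0 0)"]) (auto intro!: programmable_instr ensures_instr)
  next
    case (Suc j)
    then obtain R where R: "programmable R" "\<And>s. s 0 = 1 \<Longrightarrow>
      ensures R s (\<lambda>s'. (\<forall>i<j. s' (B + i) = (gs ! i) (map s args)) \<and> (\<forall>i<B. s' i = s i))"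
      by auto
    have c: "computable n (gs ! j)" using gs Suc.prems by simp
    obtain S where S: "programmable S" "\<And>s. s 0 = 1 \<Longrightarrow>
        ensures S s (\<lambda>s'. s' (B + j) = (gs ! j) (map s args) \<and> same_except (B + Suc j) (B + j) s s')"
      by (rule computableE[OF c args(1), of "B + Suc j" "B + j"]) (use args r in fastforce)+
    show ?case
    proof (intro exI[of _ "R O S"] conjI allI impI)
      fix s :: state assume s: "s 0 = 1"
      show "ensures (R O S) s (\<lambda>s'. (\<forall>i<Suc j. s' (B + i) = (gs ! i) (map s args)) \<and> (\<forall>i<B. s' i = s i))"
      proof (rule ensures_comp[OF R(2)[of s, OF s]])
        fix t assume t: "(\<forall>i<j. t (B + i) = (gs ! i) (map s args)) \<and> (\<forall>i<B. t i = s i)"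
        then have "t 0 = 1" using r s by simp
        moreover have m: "map t args = map s args" using t args by auto
        ultimately show "ensures S t (\<lambda>s'. (\<forall>i<Suc j. s' (B + i) = (gs ! i) (map s args)) \<and> (\<forall>i<B. s' i = s i))"
          using S(2)[of t, unfolded m] t by (auto elim!: ensures_weaken simp: same_except_def less_Suc_eq)
      qed
    qed (rule programmable_comp[OF R(1) S(1)])
  qed
  from this[of m] obtain R where R: "programmable R" "\<And>s. s 0 = 1 \<Longrightarrow>
      ensures R s (\<lambda>s'. (\<forall>i<m. s' (B + i) = (gs ! i) (map s args)) \<and> (\<forall>i<B. s' i = s i))" by auto
  obtain S where S: "programmable S" "\<And>s. s 0 = 1 \<Longrightarrow>
        ensures S s (\<lambda>s'. s' r = f (map s [B..<B+m]) \<and> same_except (B + m) r s s')"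
    by (rule computableE[OF f, where r = r and B = "B + m" and args = "[B..<B+m]"]) (use r in auto)
  show "\<exists>R. programmable R \<and> (\<forall>s. s 0 = 1 \<longrightarrow>
      ensures R s (\<lambda>s'. s' r = f (map (\<lambda>g. g (map s args)) gs) \<and> same_except B r s s'))"
  proof (intro exI[of _ "R O S"] conjI allI impI)
    fix s :: state assume s: "s 0 = 1"
    show "ensures (R O S) s (\<lambda>s'. s' r = f (map (\<lambda>g. g (map s args)) gs) \<and> same_except B r s s')"
    proof (rule ensures_comp[OF R(2)[of s, OF s]])
      fix t assume t: "(\<forall>i<m. t (B + i) = (gs ! i) (map s args)) \<and> (\<forall>i<B. t i = s i)"
      have 0: "t 0 = 1" using r s t by simp
      have "map t [B..<B+m] = map (\<lambda>g. g (map s args)) gs"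
        using t gs by (intro nth_equalityI) auto
      then show "ensures S t (\<lambda>s'. s' r = f (map (\<lambda>g. g (map s args)) gs) \<and> same_except B r s s')"
        using S(2)[of t, OF 0] t by (auto elim!: ensures_weaken simp: same_except_def)
    qed
  qed (rule programmable_comp[OF R(1) S(1)])
qed

text \<open>Register \<open>B\<close> is the counter, \<open>B + 1\<close> the accumulator and
  \<open>B + 2\<close> receives the next value. The target \<open>r\<close> may be one of the
  arguments, hence it is written only after the loop.\<close>

lemma computable_prim_rec:
  assumes f: "computable n f" and g: "computable (Suc (Suc n)) g"
  shows "computable (Suc n) (prim_rec_fun f g)"
  unfolding computable_def
proof (intro allI impI)
  fix args :: "nat list" and r B
  assume "length args = Suc n" and args: "\<forall>a\<in>set args. a < B" and r: "0 < r" "r < (B::nat)"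
  then obtain y ys where ys: "args = y # ys" "length ys = n" by (metis length_Suc_conv)
  let ?F = "\<lambda>s i. rec_nat (f (map s ys)) (\<lambda>z acc. g (z # acc # map s ys)) i"
  have ysB: "a < B" if "a \<in> insert y (set ys)" for a using that args ys by auto
  obtain Rf where Rf: "programmable Rf" "\<And>s. s 0 = 1 \<Longrightarrow>
        ensures Rf s (\<lambda>s'. s' (B + 1) = f (map s ys) \<and> same_except (B + 3) (B + 1) s s')"
    by (rule computableE[OF f ys(2), of "B + 3" "B + 1"]) (use ysB in fastforce)+
  obtain Rg where Rg: "programmable Rg" "\<And>s. s 0 = 1 \<Longrightarrow>
        ensures Rg s (\<lambda>s'. s' (B + 2) = g (map s (B # (B + 1) # ys)) \<and> same_except (B + 3) (B + 2) s s')"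
    by (rule computableE[OF g, of "B # (B + 1) # ys" "B + 3" "B + 2"]) (use ysB ys in fastforce)+
  let ?clear = "instr_rel (Assign B 0 0 0 0)"
  let ?body = "Rg O (instr_rel (Assign (B + 1) 1 (B + 2) 0 0) O instr_rel (Assign B 1 B 1 0))"
  \<comment> \<open>The test discards every run that leaves the loop before or after round
    \<open>s y\<close>.\<close>
  let ?exit = "instr_rel (Test B y) O instr_rel (Assign r 1 (B + 1) 0 0)"
  let ?P = "Rf O (?clear O (?body\<^sup>* O ?exit))"
  have "programmable ?P"
    using r by (intro programmable_comp programmable_star programmable_instr Rf Rg) auto
  moreover have "ensures ?P s (\<lambda>s'. s' r = prim_rec_fun f g (map s args) \<and> same_except B r s s')"
    if s: "s 0 = 1" for s :: state
  proof (rule ensures_comp[OF Rf(2)[of s, OF s]])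
    fix t1 assume t1: "t1 (B + 1) = f (map s ys) \<and> same_except (B + 3) (B + 1) s t1"
    define Inv where "Inv = (\<lambda>i (t::state). t B = i \<and> t (B + 1) = ?F s i \<and> (\<forall>j<B. t j = s j))"
    have body: "ensures ?body t (Inv (Suc i))" if I: "Inv i t" for i t
    proof -
      have t0: "t 0 = 1" using I r s by (auto simp: Inv_def)
      have m: "map t ys = map s ys" using I ysB by (auto simp: Inv_def)
      have "ensures Rg t (\<lambda>t'. t' (B + 2) = ?F s (Suc i) \<and> t' B = i \<and> (\<forall>j<B. t' j = s j))"
        using Rg(2)[of t, OF t0] I by (auto elim!: ensures_weaken simp: m Inv_def same_except_def)
      then show ?thesis
        by (rule ensures_comp) (use r s in \<open>auto intro!: ensures_instr_comp ensures_instr simp: Inv_def\<close>)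
    qed
    show "ensures (?clear O (?body\<^sup>* O ?exit)) t1 (\<lambda>s'. s' r = prim_rec_fun f g (map s args) \<and> same_except B r s s')"
    proof (rule ensures_comp[OF ensures_instr])
      show "(\<lambda>t. Inv 0 t) (exec (Assign B 0 0 0 0) t1)"
        using t1 by (auto simp: Inv_def same_except_def)
      fix t assume "Inv 0 t"
      then show "ensures (?body\<^sup>* O ?exit) t (\<lambda>s'. s' r = prim_rec_fun f g (map s args) \<and> same_except B r s s')"
      proof (rule ensures_loop[where N = "s y"])
        fix i t t' assume "Inv i t" "(t, t') \<in> ?body"
        with body show "Inv (Suc i) t'" unfolding ensures_def by blast
      next
        fix i t assume "Inv i t"
        with body show "\<exists>t'. (t, t') \<in> ?body" unfolding ensures_def by blast
      next
        fix t assume "Inv (s y) t"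
        then show "\<exists>t'. (t, t') \<in> ?exit" using ysB by (fastforce simp: Inv_def instr_rel_def)
      next
        fix i t t' assume "Inv i t" "(t, t') \<in> ?exit"
        then show "t' r = prim_rec_fun f g (map s args) \<and> same_except B r s t'"
          using ysB by (auto simp: Inv_def instr_rel_def prim_rec_fun_def ys same_except_def)
      qed
    qed simp
  qed
  ultimately show "\<exists>R. programmable R \<and> (\<forall>s. s 0 = 1 \<longrightarrow>
      ensures R s (\<lambda>s'. s' r = prim_rec_fun f g (map s args) \<and> same_except B r s s'))" by blast
qed

text \<open>With equality tests alone, positivity is certified by a guess: register \<open>t\<close>
  starts at 1, is incremented arbitrarily often and must finally equal register
  \<open>a\<close>.\<close>

lemma programmable_positive:
  assumes "0 < a" "0 < t" "a \<noteq> t"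
  obtains R where "programmable R"
    "\<And>s s'. s 0 = 1 \<Longrightarrow> (s, s') \<in> R \<Longrightarrow> 0 < s a \<and> (\<forall>i. i \<noteq> t \<longrightarrow> s' i = s i)"
    "\<And>s. s 0 = 1 \<Longrightarrow> 0 < s a \<Longrightarrow> \<exists>s'. (s, s') \<in> R"
proof -
  let ?inc = "instr_rel (Assign t 1 t 1 0)"
  let ?R = "instr_rel (Assign t 1 0 0 0) O (?inc\<^sup>* O instr_rel (Test t a))"
  have inc: "s' t \<ge> s t \<and> (\<forall>i. i \<noteq> t \<longrightarrow> s' i = s i)" if "(s, s') \<in> ?inc\<^sup>*" for s s'
    using that by (induction rule: rtrancl_induct) (auto simp: instr_rel_def)
  have up: "(s, s(t := s t + n)) \<in> ?inc\<^sup>*" if "s 0 = 1" for s :: state and n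
  proof (induction n)
    case (Suc n)
    have "(s(t := s t + n), s(t := s t + Suc n)) \<in> ?inc"
      using that assms unfolding instr_rel_def by auto
    with Suc show ?case by (meson rtrancl.rtrancl_into_rtrancl)
  qed simp
  show ?thesis
  proof (rule that[of ?R])
    show "programmable ?R"
      using assms by (intro programmable_comp programmable_star programmable_instr) auto
    fix s :: state assume s: "s 0 = 1"
    show "0 < s a \<and> (\<forall>i. i \<noteq> t \<longrightarrow> s' i = s i)" if "(s, s') \<in> ?R" for s'
    proof -
      have "(s(t := 1), s') \<in> ?inc\<^sup>*" "s' t = s' a" using that s by (auto simp: instr_rel_def)
      with inc[OF this(1)] assms show ?thesis by auto
    qed
    show "\<exists>s'. (s, s') \<in> ?R" if "0 < s a"
    proof -
      have "(s(t := 1), s(t := s a)) \<in> ?inc\<^sup>*"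
        using up[of "s(t := 1)" "s a - 1"] that s assms by simp
      moreover have "(s, s(t := 1)) \<in> instr_rel (Assign t 1 0 0 0)" using s by (auto simp: instr_rel_def)
      moreover have "(s(t := s a), s(t := s a)) \<in> instr_rel (Test t a)"
        using assms by (auto simp: instr_rel_def)
      ultimately show ?thesis by blast
    qed
  qed
qed

lemma computable_least:
  assumes g: "computable (Suc n) g" and total: "\<forall>xs. length xs = n \<longrightarrow> (\<exists>y. g (y # xs) = 0)"
  shows "computable n (\<lambda>xs. LEAST y. g (y # xs) = 0)"
  unfolding computable_def
proof (intro allI impI)
  fix args :: "nat list" and r B
  assume args: "length args = n" "\<forall>a\<in>set args. a < B" and r: "0 < r" "r < (B::nat)"
  obtain Rg where Rg: "programmable Rg" "\<And>s. s 0 = 1 \<Longrightarrow>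
        ensures Rg s (\<lambda>s'. s' (B + 1) = g (map s (B # args)) \<and> same_except (B + 3) (B + 1) s s')"
    by (rule computableE[OF g, of "B # args" "B + 3" "B + 1"]) (use args in fastforce)+
  obtain Rp where Rp: "programmable Rp"
    "\<And>s s'. s 0 = 1 \<Longrightarrow> (s, s') \<in> Rp \<Longrightarrow> 0 < s (B + 1) \<and> (\<forall>i. i \<noteq> B + 2 \<longrightarrow> s' i = s i)"
    "\<And>s. s 0 = 1 \<Longrightarrow> 0 < s (B + 1) \<Longrightarrow> \<exists>s'. (s, s') \<in> Rp"
    by (rule programmable_positive[of "B + 1" "B + 2"]) auto
  \<comment> \<open>Register \<open>B\<close> holds the candidate. A round may pass it only if the
    value of \<open>g\<close> is certified positive; the exit recomputes the value and compares it
    with the cleared register \<open>B + 2\<close>.\<close>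
  let ?body = "Rg O (Rp O instr_rel (Assign B 1 B 1 0))"
  let ?exit = "Rg O (instr_rel (Assign (B + 2) 0 0 0 0) O (instr_rel (Test (B + 1) (B + 2)) O instr_rel (Assign r 1 B 0 0)))"
  let ?P = "instr_rel (Assign B 0 0 0 0) O (?body\<^sup>* O ?exit)"
  have "programmable ?P"
    using r by (intro programmable_comp programmable_star programmable_instr Rg Rp) auto
  moreover have "ensures ?P s (\<lambda>s'. s' r = (LEAST y. g (y # map s args) = 0) \<and> same_except B r s s')"
    if s: "s 0 = 1" for s :: state
  proof -
    let ?G = "\<lambda>y. g (y # map s args)"
    define N where "N = (LEAST y. ?G y = 0)"
    have N: "?G N = 0" unfolding N_def using total args by (auto intro: LeastI_ex)
    have N_less: "0 < ?G y" if "y < N" for y using not_less_Least that unfolding N_def by blast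
    define Inv where "Inv = (\<lambda>i (t::state). t B = i \<and> (\<forall>j<i. 0 < ?G j) \<and> (\<forall>j<B. t j = s j))"
    have Rg': "ensures Rg t (\<lambda>t'. t' (B + 1) = ?G i \<and> t' B = i \<and> (\<forall>j<B. t' j = s j))"
      if I: "Inv i t" for i t
    proof -
      have t0: "t 0 = 1" using I r s by (auto simp: Inv_def)
      have m: "map t args = map s args" using I args by (auto simp: Inv_def)
      show ?thesis using Rg(2)[of t, OF t0] I by (auto elim!: ensures_weaken simp: m Inv_def same_except_def)
    qed
    show ?thesis
    proof (rule ensures_comp[OF ensures_instr])
      show "(\<lambda>t. Inv 0 t) (exec (Assign B 0 0 0 0) s)" by (auto simp: Inv_def)
      fix t assume "Inv 0 t"
      then show "ensures (?body\<^sup>* O ?exit) t (\<lambda>s'. s' r = (LEAST y. ?G y = 0) \<and> same_except B r s s')"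
      proof (rule ensures_loop[where N = N])
        fix i t t' assume I: "Inv i t" and "(t, t') \<in> ?body"
        then obtain u v where u: "(t, u) \<in> Rg" "(u, v) \<in> Rp" "t' = exec (Assign B 1 B 1 0) v"
          unfolding instr_rel_def by blast
        have u': "u (B + 1) = ?G i \<and> u B = i \<and> (\<forall>j<B. u j = s j)" using Rg'[OF I] u unfolding ensures_def by blast
        then have "u 0 = 1" using r s by simp
        from Rp(2)[of u, OF this u(2)] show "Inv (Suc i) t'"
          using u' u(3) I r s by (auto simp: Inv_def less_Suc_eq)
      next
        fix i t assume i: "i < N" and I: "Inv i t"
        obtain u where u: "(t, u) \<in> Rg" and u': "u (B + 1) = ?G i \<and> u B = i \<and> (\<forall>j<B. u j = s j)"
          using Rg'[OF I] unfolding ensures_def by blast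
        then have "u 0 = 1" using r s by simp
        from Rp(3)[of u, OF this] obtain v where "(u, v) \<in> Rp" using u' N_less[OF i] by auto
        then show "\<exists>t'. (t, t') \<in> ?body" using u unfolding instr_rel_def by fastforce
      next
        fix t assume I: "Inv N t"
        then obtain u where u: "(t, u) \<in> Rg" "u (B + 1) = 0"
          using Rg'[OF I] N unfolding ensures_def by auto
        then show "\<exists>t'. (t, t') \<in> ?exit"
          by (intro exI[of _ "u(B + 2 := 0, r := u B)"] relcompI[OF u(1)] relcompI[of _ "u(B + 2 := 0)"])
            (auto simp: instr_rel_def)
      next
        fix i t t' assume I: "Inv i t" and "(t, t') \<in> ?exit"
        then obtain u where u: "(t, u) \<in> Rg" "u (B + 1) = 0" "t' = u(B + 2 := 0, r := u B)"
          using r by (auto simp: instr_rel_def)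
        have u': "u (B + 1) = ?G i \<and> u B = i \<and> (\<forall>j<B. u j = s j)" using Rg'[OF I] u unfolding ensures_def by blast
        \<comment> \<open>The exit test gives a zero at \<open>i\<close> and the invariant excludes
          smaller ones, so a run can end only at the least zero.\<close>
        have "(LEAST y. ?G y = 0) = i"
          using u u' I by (intro Least_equality) (auto simp: Inv_def not_less[symmetric])
        then show "t' r = (LEAST y. ?G y = 0) \<and> same_except B r s t'"
          using u u' r by (auto simp: same_except_def)
      qed
    qed simp
  qed
  ultimately show "\<exists>R. programmable R \<and> (\<forall>s. s 0 = 1 \<longrightarrow>
      ensures R s (\<lambda>s'. s' r = (LEAST y. g (y # map s args) = 0) \<and> same_except B r s s'))" by blast
qed

lemma recfn_computable: "recfn n f \<Longrightarrow> computable n f"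
proof (induction rule: recfn.induct)
  case (rf_zero n)
  show ?case by (rule computable_single) (auto intro!: exI[of _ 0])
next
  case rf_succ
  show ?case
  proof (rule computable_single)
    fix args :: "nat list" assume "length args = 1"
    then obtain a where "args = [a]" by (auto simp: length_Suc_conv)
    then have "\<forall>s::state. s 0 = 1 \<longrightarrow> 1 * s a + 1 * s 0 = Suc (hd (map s args))" by simp
    then show "\<exists>x a y b. \<forall>s::state. s 0 = 1 \<longrightarrow> x * s a + y * s b = Suc (hd (map s args))" by blast
  qed
next
  case (rf_proj i n)
  show ?case
  proof (rule computable_single)
    fix args :: "nat list" assume "length args = n"
    then have "\<forall>s::state. s 0 = 1 \<longrightarrow> 1 * s (args ! i) + 0 * s 0 = map s args ! i"
      using rf_proj by simp
    then show "\<exists>x a y b. \<forall>s::state. s 0 = 1 \<longrightarrow> x * s a + y * s b = map s args ! i" by blast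
  qed
next
  case (rf_comp m f gs n)
  then show ?case by (intro computable_comp) auto
next
  case (rf_prec n f g)
  then show ?case by (intro computable_prim_rec)
next
  case (rf_min n g)
  then show ?case by (intro computable_least)
qed

section \<open>Regular sequences\<close>

lemma sum_of_bool_mult: "a < (m::nat) \<Longrightarrow> (\<Sum>j<m. of_bool (j = a) * f j) = (f a :: int)"
  by (subst sum.cong[OF refl, of _ _ "\<lambda>j. if j = a then f j else 0"]) auto

definition psum :: "(nat \<Rightarrow> int) \<Rightarrow> nat \<Rightarrow> int" where
  "psum x n = (\<Sum>m<n. x m)"

lemma palindrome_psum_iff:
  assumes "\<And>n. 0 \<le> g n"
  shows "has_nontrivial_palindrome (psum g) \<longleftrightarrow> (\<exists>n. g n = 0)"
proof
  assume "has_nontrivial_palindrome (psum g)"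
  then obtain i L where L: "2 \<le> L" "\<forall>t<L. psum g (i + t) = psum g (i + L - 1 - t)"
    unfolding has_nontrivial_palindrome_def by blast
  \<comment> \<open>As \<open>L\<close> is at least 2, the last position of the palindrome is at
    least \<open>Suc i\<close>, and partial sums are monotone. The palindrome equation for
    \<open>t = 0\<close> then squeezes \<open>g i\<close> to 0.\<close>
  have "psum g (Suc i) \<le> psum g (i + L - 1)"
    unfolding psum_def using assms L by (intro sum_mono2) auto
  also have "\<dots> = psum g i" using L(1) L(2)[rule_format, of 0] by simp
  finally have "g i \<le> 0" by (simp add: psum_def)
  with assms[of i] show "\<exists>n. g n = 0" by (intro exI[of _ i]) simp
next
  assume "\<exists>n. g n = 0"
  then obtain n where "psum g (Suc n) = psum g n" by (auto simp: psum_def)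
  then show "has_nontrivial_palindrome (psum g)"
    unfolding has_nontrivial_palindrome_def by (intro exI[of _ n] exI[of _ 2]) (auto simp: less_2_cases_iff)
qed

section \<open>Integer spans of sequences and linear representations\<close>

definition lincomb :: "(nat \<Rightarrow> int) list \<Rightarrow> (nat \<Rightarrow> int) \<Rightarrow> bool" where
  "lincomb L x \<longleftrightarrow> (\<exists>c. \<forall>n. x n = (\<Sum>i<length L. c i * (L ! i) n))"

lemma lincomb_member:
  assumes "x \<in> set L"
  shows "lincomb L x"
proof -
  obtain i where "i < length L" "L ! i = x" using assms by (auto simp: in_set_conv_nth)
  then show ?thesis unfolding lincomb_def
    by (intro exI[of _ "\<lambda>j. of_bool (j = i)"]) (simp add: sum_of_bool_mult)
qed

lemma lincomb_add: "lincomb L x \<Longrightarrow> lincomb L y \<Longrightarrow> lincomb L (\<lambda>n. x n + y n)"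
  unfolding lincomb_def
proof (elim exE)
  fix c d assume "\<forall>n. x n = (\<Sum>i<length L. c i * (L ! i) n)" "\<forall>n. y n = (\<Sum>i<length L. d i * (L ! i) n)"
  then show "\<exists>c. \<forall>n. x n + y n = (\<Sum>i<length L. c i * (L ! i) n)"
    by (intro exI[of _ "\<lambda>i. c i + d i"]) (simp add: sum.distrib distrib_right)
qed

lemma lincomb_mult: "lincomb L x \<Longrightarrow> lincomb L (\<lambda>n. a * x n)"
  unfolding lincomb_def
proof (elim exE)
  fix c assume "\<forall>n. x n = (\<Sum>i<length L. c i * (L ! i) n)"
  then show "\<exists>c. \<forall>n. a * x n = (\<Sum>i<length L. c i * (L ! i) n)"
    by (intro exI[of _ "\<lambda>i. a * c i"]) (simp add: sum_distrib_left mult.assoc)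
qed

lemma lincomb_sum:
  assumes "\<And>i. i \<in> A \<Longrightarrow> lincomb L (x i)"
  shows "lincomb L (\<lambda>n. \<Sum>i\<in>A. x i n)"
proof -
  have z: "lincomb L (\<lambda>n. 0)" unfolding lincomb_def by (intro exI[of _ "\<lambda>_. 0"]) simp
  show ?thesis
  proof (cases "finite A")
    case True
    then show ?thesis using assms by (induction rule: finite_induct) (auto simp: z intro: lincomb_add)
  qed (simp add: z)
qed

lemma lincomb_trans:
  assumes "lincomb L x" "\<And>y. y \<in> set L \<Longrightarrow> lincomb L' y"
  shows "lincomb L' x"
proof -
  obtain c where "x = (\<lambda>n. \<Sum>i<length L. c i * (L ! i) n)" using assms(1) unfolding lincomb_def by blast
  moreover have "lincomb L' (\<lambda>n. \<Sum>i<length L. c i * (L ! i) n)"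
    by (rule lincomb_sum, rule lincomb_mult, rule assms(2)) simp
  ultimately show ?thesis by simp
qed

lemma lincomb_psum:
  assumes "lincomb L x"
  shows "lincomb (map psum L) (psum x)"
proof -
  obtain c where c: "x = (\<lambda>n. \<Sum>i<length L. c i * (L ! i) n)" using assms unfolding lincomb_def by blast
  have "psum x n = (\<Sum>i<length L. c i * (map psum L ! i) n)" for n
    unfolding psum_def c by (subst sum.swap) (simp add: psum_def sum_distrib_left)
  then show ?thesis unfolding lincomb_def by (intro exI[of _ c]) simp
qed

text \<open>The integer span of \<open>L\<close> is stable under the maps that generate the
  \<open>k\<close>-kernel, the usual module criterion for \<open>k\<close>-regularity. Integer
  coefficients are essential, since they become the matrix entries.\<close>

definition kernel_closed :: "nat \<Rightarrow> (nat \<Rightarrow> int) list \<Rightarrow> bool" where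
  "kernel_closed k L \<longleftrightarrow> (\<forall>x\<in>set L. \<forall>d<k. lincomb L (\<lambda>n. x (k * n + d)))"

text \<open>The first \<open>k * n\<close> terms are sorted by their residue modulo
  \<open>k\<close>; the last \<open>d\<close> terms form an incomplete block.\<close>

lemma psum_mult_add:
  "psum x (k * n + d) = (\<Sum>e<k. psum (\<lambda>n. x (k * n + e)) n) + (\<Sum>e<d. x (k * n + e))"
proof -
  have add: "psum x (a + b) = psum x a + (\<Sum>e<b. x (a + e))" for a b
    by (induction b) (simp_all add: psum_def)
  have "psum x (k * n) = (\<Sum>e<k. psum (\<lambda>n. x (k * n + e)) n)" for n
  proof (induction n)
    case (Suc n)
    have "psum x (k * Suc n) = psum x (k * n + k)" by (simp add: add.commute)
    then show ?case using Suc unfolding add by (simp add: psum_def sum.distrib)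
  qed (simp add: psum_def)
  then show ?thesis by (simp add: add)
qed

text \<open>By \<open>psum_mult_add\<close>, the span of \<open>L\<close> and its partial sums is
  closed. The duplicates \<open>P\<close> put selected partial sums at the front, where the input
  will be placed in the row vector.\<close>

lemma kernel_closed_psum:
  assumes L: "kernel_closed k L" and P: "set P \<subseteq> set (map psum L)"
  shows "kernel_closed k (P @ L @ map psum L)"
  unfolding kernel_closed_def
proof (intro ballI allI impI)
  let ?L = "P @ L @ map psum L"
  fix y d assume y: "y \<in> set ?L" and d: "d < k"
  have lift: "lincomb ?L z" if "lincomb L z" for z
    using that by (rule lincomb_trans) (auto intro: lincomb_member)
  have lift_psum: "lincomb ?L (psum z)" if "lincomb L z" for z
    using lincomb_psum[OF that] by (rule lincomb_trans) (auto intro!: lincomb_member)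
  from y P consider "y \<in> set L" | x where "x \<in> set L" "y = psum x" by auto
  then show "lincomb ?L (\<lambda>n. y (k * n + d))"
  proof cases
    case 1
    then show ?thesis using L d lift unfolding kernel_closed_def by blast
  next
    case 2
    have c: "lincomb L (\<lambda>n. x (k * n + e))" if "e < k" for e
      using L 2 that unfolding kernel_closed_def by blast
    show ?thesis unfolding 2 psum_mult_add using d
      by (intro lincomb_add lincomb_sum lift lift_psum c) auto
  qed
qed

text \<open>Row \<open>i\<close> of the matrix for \<open>d\<close> expresses the
  \<open>i\<close>-th sequence at \<open>k * n + d\<close> through the family at \<open>n\<close>.
  After some low digits are read, the row vector holds the coefficients of the value at the
  remaining quotient. Both \<open>w\<close> and \<open>Ms\<close> are chosen before
  \<open>v\<close>, so the input can vary with these parts fixed.\<close>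

lemma linrep_of_kernel_closed:
  assumes k: "2 \<le> k" and L: "kernel_closed k L"
  obtains w Ms where "\<And>v. length v = length L \<Longrightarrow> valid_linrep k (v, w, Ms)"
    "\<And>v n. length v = length L \<Longrightarrow> linrep_seq k (v, w, Ms) n = (\<Sum>i<length L. v ! i * (L ! i) n)"
proof -
  let ?r = "length L"
  have "\<exists>c. \<forall>n. (L ! i) (k * n + d) = (\<Sum>j<?r. c j * (L ! j) n)" if "d < k" "i < ?r" for d i
    using L that unfolding kernel_closed_def lincomb_def by (meson nth_mem)
  then obtain c where c: "\<And>d i n. d < k \<Longrightarrow> i < ?r \<Longrightarrow>
      (L ! i) (k * n + d) = (\<Sum>j<?r. c d i j * (L ! j) n)" by metis
  define M where "M = (\<lambda>d. map (\<lambda>i. map (c d i) [0..<?r]) [0..<?r])"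
  \<comment> \<open>When all digits are read the quotient is 0, so the column vector lists the
    values at 0.\<close>
  let ?w = "map (\<lambda>x. x 0) L" and ?Ms = "map M [0..<k]"
  have step: "(\<Sum>i<?r. v ! i * (L ! i) (k * n + d)) = (\<Sum>j<?r. vecmat v (?Ms ! d) ! j * (L ! j) n)"
    and len: "length (vecmat v (?Ms ! d)) = ?r"
    if "d < k" "length v = ?r" for v d n
  proof -
    have "(\<Sum>i<?r. v ! i * (L ! i) (k * n + d)) = (\<Sum>i<?r. \<Sum>j<?r. v ! i * c d i j * (L ! j) n)"
      using that by (simp add: c sum_distrib_left mult.assoc)
    also have "\<dots> = (\<Sum>j<?r. \<Sum>i<?r. v ! i * c d i j * (L ! j) n)" by (rule sum.swap)
    finally show "(\<Sum>i<?r. v ! i * (L ! i) (k * n + d)) = (\<Sum>j<?r. vecmat v (?Ms ! d) ! j * (L ! j) n)"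
      using that by (simp add: vecmat_def M_def sum_distrib_right)
    show "length (vecmat v (?Ms ! d)) = ?r" using that by (simp add: vecmat_def)
  qed
  have "dotp (foldl (\<lambda>x d. vecmat x (?Ms ! d)) v (digits k n)) ?w = (\<Sum>i<?r. v ! i * (L ! i) n)"
    if "length v = ?r" for v n
    using that
  proof (induction n arbitrary: v rule: less_induct)
    case (less n)
    show ?case
    proof (cases "n = 0")
      case True
      then show ?thesis using less.prems
        by (simp add: dotp_def sum_list_sum_nth atLeast0LessThan)
    next
      case False
      have d: "n mod k < k" using k by simp
      have "digits k n = n mod k # digits k (n div k)" using False k by (subst digits.simps) simp
      moreover have "n div k < n" using False k by simp
      ultimately show ?thesis
        using less.IH[of "n div k"] step[OF d less.prems, of "n div k"] len[OF d less.prems] by simp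
    qed
  qed
  moreover have "valid_linrep k (v, ?w, ?Ms)" if "length v = ?r" for v
    using that by (auto simp: valid_linrep_def M_def)
  ultimately show ?thesis by (intro that[of ?w ?Ms]) (simp_all add: linrep_seq_def)
qed

section \<open>The cost of a run\<close>

fun instr_mat :: "instr \<Rightarrow> nat \<Rightarrow> nat \<Rightarrow> int" where
  "instr_mat (Assign c x a y b) i j =
     (if i = c then int x * of_bool (j = a) + int y * of_bool (j = b) else of_bool (j = i))"
| "instr_mat (Test a b) i j = of_bool (j = i)"

fun instr_form :: "instr \<Rightarrow> nat \<Rightarrow> int" where
  "instr_form (Assign c x a y b) j = 0"
| "instr_form (Test a b) j = of_bool (j = a) - of_bool (j = b)"

fun uses_below :: "nat \<Rightarrow> instr \<Rightarrow> bool" where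
  "uses_below m (Assign c x a y b) = (c < m \<and> a < m \<and> b < m)"
| "uses_below m (Test a b) = (a < m \<and> b < m)"

lemma exec_eq_instr_mat:
  assumes "uses_below m I" "i < m"
  shows "int (exec I s i) = (\<Sum>j<m. instr_mat I i j * int (s j))"
proof (cases I)
  case (Assign c x a y b)
  then show ?thesis using assms
    by (simp add: sum_of_bool_mult distrib_right sum.distrib mult.assoc flip: sum_distrib_left)
next
  case Test
  then show ?thesis using assms by (simp add: sum_of_bool_mult)
qed

lemma guard_iff_instr_form:
  assumes "uses_below m I"
  shows "guard I s \<longleftrightarrow> (\<Sum>j<m. instr_form I j * int (s j)) = 0"
proof (cases I)
  case (Test a b)
  then show ?thesis using assms by (simp add: sum_of_bool_mult left_diff_distrib sum_subtractf)
qed simp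

lemma ex_uses_below: "finite E \<Longrightarrow> \<exists>m. \<forall>(p, I, q)\<in>(E::edge set). uses_below m I"
proof (induction rule: finite_induct)
  case (insert e E)
  then obtain m where m: "\<forall>(p, I, q)\<in>E. uses_below m I" by blast
  obtain p I q where e: "e = (p, I, q)" by (cases e) auto
  have mono: "uses_below m J \<Longrightarrow> m \<le> m' \<Longrightarrow> uses_below m' J" for J m m' by (cases J) auto
  obtain m' where "uses_below m' I"
    by (cases I) (metis uses_below.simps le_imp_less_Suc max.cobounded1 max.cobounded2 max.coboundedI2)+
  then show ?case using m e mono[of m _ "max m m'"] mono[of m' _ "max m m'"] by (intro exI[of _ "max m m'"]) fastforce
qed simp

text \<open>This is x'(M'QM)x = (Mx)'Q(Mx), with ' for transposition: a quadratic form pulled back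
  along a linear update.\<close>

lemma sum_sum_mult:
  "(\<Sum>a<m. \<Sum>b<m. (\<Sum>c<m. \<Sum>d<m. Q c d * M c a * M d b) * x a * x b)
     = (\<Sum>c<m. \<Sum>d<m. Q c d * (\<Sum>a<m. M c a * x a) * (\<Sum>b<m. M d b * x b))"
  for Q M :: "nat \<Rightarrow> nat \<Rightarrow> int" and x :: "nat \<Rightarrow> int"
proof -
  have "(\<Sum>a<m. \<Sum>b<m. (\<Sum>c<m. \<Sum>d<m. Q c d * M c a * M d b) * x a * x b)
      = (\<Sum>(a, b)\<in>{..<m} \<times> {..<m}. \<Sum>(c, d)\<in>{..<m} \<times> {..<m}. Q c d * (M c a * x a) * (M d b * x b))"
    by (simp add: sum.cartesian_product[symmetric] sum_distrib_left sum_distrib_right mult_ac)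
  also have "\<dots> = (\<Sum>(c, d)\<in>{..<m} \<times> {..<m}. \<Sum>(a, b)\<in>{..<m} \<times> {..<m}. Q c d * (M c a * x a) * (M d b * x b))"
    unfolding split_def by (rule sum.swap)
  also have "\<dots> = (\<Sum>c<m. \<Sum>d<m. Q c d * (\<Sum>a<m. M c a * x a) * (\<Sum>b<m. M d b * x b))"
    by (simp add: sum.cartesian_product[symmetric] sum_distrib_left sum_distrib_right mult_ac)
  finally show ?thesis .
qed

section \<open>The quadratic form of a program\<close>

locale penalty =
  fixes k m :: nat and es :: "edge list" and fin :: label
  assumes k: "2 \<le> k" and m: "0 < m" and es: "es \<noteq> []"
    and uses_below: "\<And>p I q. (p, I, q) \<in> set es \<Longrightarrow> uses_below m I"
    and writable: "\<And>p I q. (p, I, q) \<in> set es \<Longrightarrow> writable I"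
begin

text \<open>For \<open>k = 2\<close> a digit is only zero or nonzero, so an edge cannot be named by
  one digit. It is selected by its position in \<open>es\<close>, reached through a run of
  zeros.\<close>

definition next_index :: "nat \<Rightarrow> nat" where
  "next_index i = Suc i mod length es"

text \<open>A number is read digit by digit, least significant digit first, as a run of the program
  from label \<^term>\<open>q\<close>: the digit 0 moves the index \<^term>\<open>i\<close> cyclically to the next edge, any other
  digit takes edge \<^term>\<open>i\<close> and resets the index. These are the coefficients of the quadratic form in
  the registers that adds up the squared violations.\<close>

function coeff :: "label \<Rightarrow> nat \<Rightarrow> nat \<Rightarrow> nat \<Rightarrow> nat \<Rightarrow> int" where
  "coeff q i a b n =
     (if n = 0 then (if q = fin then 0 else of_bool (a = 0) * of_bool (b = 0))
      else if n mod k = 0 then coeff q (next_index i) a b (n div k)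
      else case es ! i of (p, I, q') \<Rightarrow>
        if p = q then instr_form I a * instr_form I b +
          (\<Sum>c<m. \<Sum>d<m. coeff q' 0 c d (n div k) * instr_mat I c a * instr_mat I d b)
        else of_bool (a = 0) * of_bool (b = 0))"
  by pat_completeness auto
termination
  by (relation "measure (\<lambda>(q, i, a, b, n). n)") (use k in auto)

declare coeff.simps [simp del]

definition cost :: "label \<Rightarrow> nat \<Rightarrow> state \<Rightarrow> nat \<Rightarrow> int" where
  "cost q i s n = (\<Sum>a<m. \<Sum>b<m. coeff q i a b n * int (s a) * int (s b))"

text \<open>The square of register 0 acts as a constant penalty 1. It is charged for stopping at a
  label other than \<open>fin\<close> and for choosing an edge that does not start at the current
  label.\<close>

lemma sum_of_bool_zero:
  assumes "s 0 = 1"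
  shows "(\<Sum>a<m. \<Sum>b<m. of_bool (a = 0) * of_bool (b = 0) * int (s a) * int (s b)) = 1"
proof -
  have "(\<Sum>a<m. \<Sum>b<m. of_bool (a = 0) * of_bool (b = 0) * int (s a) * int (s b))
      = (\<Sum>a<m. of_bool (a = 0) * (\<Sum>b<m. of_bool (b = 0) * (int (s a) * int (s b))))"
    unfolding sum_distrib_left mult.assoc ..
  then show ?thesis unfolding sum_of_bool_mult[OF m] using assms by simp
qed

lemma cost_zero: "s 0 = 1 \<Longrightarrow> cost q i s 0 = (if q = fin then 0 else 1)"
  using sum_of_bool_zero[of s] by (simp add: cost_def coeff.simps)

lemma coeff_shift: "coeff q i a b (k * n) = (if n = 0 then coeff q i a b 0 else coeff q (next_index i) a b n)"
  using k by (subst coeff.simps) (auto simp: coeff.simps[of _ _ _ _ 0])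

lemma cost_shift: "n > 0 \<Longrightarrow> cost q i s (k * n) = cost q (next_index i) s n"
  by (simp add: cost_def coeff_shift)

lemma coeff_take:
  assumes "0 < d" "d < k" "es ! i = (p, I, q')"
  shows "coeff q i a b (k * n + d) = (if p = q then instr_form I a * instr_form I b +
          (\<Sum>c<m. \<Sum>d<m. coeff q' 0 c d n * instr_mat I c a * instr_mat I d b)
        else of_bool (a = 0) * of_bool (b = 0))"
  using assms by (subst coeff.simps) simp

text \<open>The products of \<open>instr_form\<close> values add up to the squared violation of the
  test. By \<open>sum_sum_mult\<close>, the pulled back form takes the value of the remaining form
  at \<open>exec I s\<close>.\<close>

lemma cost_take:
  assumes d: "0 < d" "d < k" and i: "i < length es" "es ! i = (p, I, q')" and s: "s 0 = 1"
  shows "cost q i s (k * n + d) =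
    (if p = q then (\<Sum>a<m. instr_form I a * int (s a))\<^sup>2 + cost q' 0 (exec I s) n else 1)"
proof (cases "p = q")
  case True
  have I: "uses_below m I" using i uses_below by (metis nth_mem)
  have "cost q i s (k * n + d) = (\<Sum>a<m. \<Sum>b<m. instr_form I a * int (s a) * (instr_form I b * int (s b))) +
      (\<Sum>a<m. \<Sum>b<m. (\<Sum>c<m. \<Sum>d<m. coeff q' 0 c d n * instr_mat I c a * instr_mat I d b) * int (s a) * int (s b))"
    using True by (simp add: cost_def coeff_take[OF d i(2)] distrib_left sum.distrib mult_ac)
  also have "\<dots> = (\<Sum>a<m. instr_form I a * int (s a))\<^sup>2 + cost q' 0 (exec I s) n"
    unfolding sum_sum_mult cost_def power2_eq_square sum_product
    by (simp add: exec_eq_instr_mat[OF I])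
  finally show ?thesis using True by simp
next
  case False
  then show ?thesis using sum_of_bool_zero[of s, OF s] by (simp add: cost_def coeff_take[OF d i(2)])
qed

section \<open>Zero cost and accepting runs\<close>

lemma exec_one: "(p, I, q) \<in> set es \<Longrightarrow> s 0 = 1 \<Longrightarrow> exec I s 0 = 1"
  using writable[of p I q] by (cases I) auto

lemma next_index_less: "next_index i < length es"
  using es by (simp add: next_index_def)

text \<open>The cases follow the recursion of \<open>coeff\<close>. A nonzero number ending in the
  digit 0 has a nonzero quotient, as \<open>cost_shift\<close> requires.\<close>

lemma digit_cases:
  obtains "n = 0" | n' where "0 < n'" "n = k * n'" "n' < n" | n' d where "0 < d" "d < k" "n = k * n' + d" "n' < n"
proof -
  have n: "n = k * (n div k) + n mod k" by simp
  have "n mod k < k" using k by simp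
  moreover have "n div k < n" if "n \<noteq> 0" using that k by simp
  moreover have "0 < n div k" if "n \<noteq> 0" "n mod k = 0" using that n by (cases "n div k") auto
  ultimately show ?thesis using that n by (metis add.right_neutral neq0_conv)
qed

lemma cost_nonneg: "s 0 = 1 \<Longrightarrow> i < length es \<Longrightarrow> 0 \<le> cost q i s n"
proof (induction n arbitrary: q i s rule: less_induct)
  case (less n)
  obtain p I q' where e: "es ! i = (p, I, q')" by (cases "es ! i") auto
  then have e': "(p, I, q') \<in> set es" using less.prems by (metis nth_mem)
  show ?case
  proof (cases n rule: digit_cases)
    case 1
    then show ?thesis using cost_zero[of s] less.prems by simp
  next
    case (2 n')
    then show ?thesis using cost_shift less next_index_less by simp
  next
    case (3 n' d)
    have "0 \<le> cost q' 0 (exec I s) n'"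
      using less.IH[OF 3(4)] exec_one[where s = s, OF e' less.prems(1)] es by simp
    then show ?thesis unfolding 3(3) cost_take[where s = s, OF 3(1,2) less.prems(2) e less.prems(1)] by simp
  qed
qed

lemma path_of_cost_zero:
  "s 0 = 1 \<Longrightarrow> i < length es \<Longrightarrow> cost q i s n = 0 \<Longrightarrow> \<exists>s'. ((q, s), (fin, s')) \<in> (step (set es))\<^sup>*"
proof (induction n arbitrary: q i s rule: less_induct)
  case (less n)
  obtain p I q' where e: "es ! i = (p, I, q')" by (cases "es ! i") auto
  then have e': "(p, I, q') \<in> set es" using less.prems by (metis nth_mem)
  show ?case
  proof (cases n rule: digit_cases)
    case 1
    then have "q = fin" using cost_zero[of s q i] less.prems by (simp split: if_splits)
    then show ?thesis by blast
  next
    case (2 n')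
    then have "cost q (next_index i) s n' = 0" using cost_shift[of n' q i s] less.prems by simp
    then show ?thesis using less.IH[where s = s, OF 2(3) less.prems(1) next_index_less] by blast
  next
    case (3 n' d)
    have "0 \<le> cost q' 0 (exec I s) n'"
      using cost_nonneg exec_one[where s = s, OF e' less.prems(1)] es by simp
    moreover have "(if p = q then (\<Sum>a<m. instr_form I a * int (s a))\<^sup>2 + cost q' 0 (exec I s) n' else 1) = 0"
      using less.prems(3) unfolding 3(3) cost_take[where s = s, OF 3(1,2) less.prems(2) e less.prems(1)] .
    \<comment> \<open>The alternative value 1 is excluded, and two nonnegative summands with sum 0
      both vanish.\<close>
    ultimately have *: "p = q" "(\<Sum>a<m. instr_form I a * int (s a)) = 0" "cost q' 0 (exec I s) n' = 0"
      by (auto split: if_splits simp: add_nonneg_eq_0_iff)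
    then have "((q, s), (q', exec I s)) \<in> step (set es)"
      using e' guard_iff_instr_form[OF uses_below[OF e']] by (intro stepI[of _ I]) auto
    moreover obtain s' where "((q', exec I s), (fin, s')) \<in> (step (set es))\<^sup>*"
      using less.IH[where s = "exec I s", OF 3(4) exec_one[where s = s, OF e' less.prems(1)] _ *(3)] es by auto
    ultimately show ?thesis by (meson converse_rtrancl_into_rtrancl)
  qed
qed

text \<open>The number is built from the end of the run backwards. An edge at position
  \<open>j\<close> contributes the digit 1 with \<open>j\<close> zeros below it.\<close>

lemma cost_zero_of_path:
  "((q, s), (fin, s')) \<in> (step (set es))\<^sup>* \<Longrightarrow> s 0 = 1 \<Longrightarrow> \<exists>n. cost q 0 s n = 0"
proof (induction rule: converse_rtrancl_induct2)
  case refl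
  then show ?case using cost_zero by (intro exI[of _ 0]) simp
next
  case (step q s q' t)
  from step(1) obtain I where I: "(q, I, q') \<in> set es" "guard I s" "t = exec I s" by (rule stepE)
  then obtain j where j: "j < length es" "es ! j = (q, I, q')" by (auto simp: in_set_conv_nth)
  obtain n where n: "cost q' 0 t n = 0" using step.IH step.prems exec_one I by auto
  have "cost q j s (k * n + 1) = 0"
    using cost_take[of 1 j q I q' s q n] guard_iff_instr_form[OF uses_below[OF I(1)]] k j n step.prems I by simp
  \<comment> \<open>Each zero advances the index by one, and below \<open>j\<close> it cannot wrap
    around; hence \<open>j - i\<close> zeros lead from \<open>i\<close> to \<open>j\<close>.\<close>
  moreover have "cost q i s (k ^ (j - i) * (k * n + 1)) = cost q j s (k * n + 1)" if "i \<le> j" for i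
    using that
  proof (induction i rule: inc_induct)
    case (step i)
    then have "cost q i s (k * (k ^ (j - Suc i) * (k * n + 1))) = cost q (next_index i) s (k ^ (j - Suc i) * (k * n + 1))"
      using k by (intro cost_shift) simp
    moreover have "next_index i = Suc i" using step j by (simp add: next_index_def)
    moreover have "k ^ (j - i) = k * k ^ (j - Suc i)" using step by (simp add: Suc_diff_Suc flip: power_Suc)
    ultimately show ?case using step.IH by (simp only: mult.assoc)
  qed simp
  ultimately show ?case by (metis zero_le)
qed

section \<open>Regularity of the coefficients\<close>

definition labels :: "label \<Rightarrow> label list" where
  "labels q0 = q0 # map (\<lambda>(p, I, q). q) es"

text \<open>A run from \<open>q0\<close> visits only \<open>q0\<close> and targets of edges, so
  finitely many sequences suffice. The constant sequence accounts for the penalties and the test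
  violations, which do not depend on the remaining digits.\<close>

definition coeff_seqs :: "label \<Rightarrow> (nat \<Rightarrow> int) list" where
  "coeff_seqs q0 = (\<lambda>_. 1) # map (\<lambda>(q, i, a, b). coeff q i a b)
     (List.product (labels q0) (List.product [0..<length es] (List.product [0..<m] [0..<m])))"

lemma coeff_seqs_iff: "x \<in> set (coeff_seqs q0) \<longleftrightarrow>
    x = (\<lambda>_. 1) \<or> (\<exists>q i a b. q \<in> set (labels q0) \<and> i < length es \<and> a < m \<and> b < m \<and> x = coeff q i a b)"
  by (auto simp: coeff_seqs_def image_iff) (metis atLeastLessThan_iff le0)+

lemma kernel_closed_coeff_seqs: "kernel_closed k (coeff_seqs q0)"
  unfolding kernel_closed_def
proof (intro ballI allI impI)
  let ?L = "coeff_seqs q0"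
  fix x d assume x: "x \<in> set ?L" and d: "d < k"
  have one: "lincomb ?L (\<lambda>_. 1)" by (rule lincomb_member) (simp add: coeff_seqs_def)
  have const: "lincomb ?L (\<lambda>_. z)" for z using lincomb_mult[OF one, of z] by simp
  show "lincomb ?L (\<lambda>n. x (k * n + d))"
  proof (cases "x = (\<lambda>_. 1)")
    case True
    then show ?thesis using one by simp
  next
    case False
    then obtain q i a b where x: "q \<in> set (labels q0)" "i < length es" "a < m" "b < m" "x = coeff q i a b"
      using x unfolding coeff_seqs_iff by blast
    obtain p I q' where e: "es ! i = (p, I, q')" by (cases "es ! i") auto
    show ?thesis
    proof (cases "d = 0")
      case True
      \<comment> \<open>For \<open>n = 0\<close> there is no digit 0 to read and the index stays,
        but the value at 0 is the same for every index.\<close>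
      have "coeff q i a b 0 = coeff q (next_index i) a b 0" by (simp add: coeff.simps)
      then have "(\<lambda>n. x (k * n + d)) = coeff q (next_index i) a b"
        using True x(5) coeff_shift by (intro ext) simp
      moreover have "coeff q (next_index i) a b \<in> set ?L"
        using x next_index_less unfolding coeff_seqs_iff by blast
      ultimately show ?thesis by (simp add: lincomb_member)
    next
      case d0: False
      have q': "q' \<in> set (labels q0)" using nth_mem[OF x(2)] unfolding e labels_def by force
      have "lincomb ?L (\<lambda>n. coeff q' 0 c d n * instr_mat I c a * instr_mat I d b)" if "c < m" "d < m" for c d
      proof -
        have "coeff q' 0 c d \<in> set ?L" using q' that es unfolding coeff_seqs_iff by blast
        then have "lincomb ?L (\<lambda>n. (instr_mat I c a * instr_mat I d b) * coeff q' 0 c d n)"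
          by (intro lincomb_mult lincomb_member)
        then show ?thesis by (simp add: mult_ac)
      qed
      then have "lincomb ?L (\<lambda>n. instr_form I a * instr_form I b +
          (\<Sum>c<m. \<Sum>d<m. coeff q' 0 c d n * instr_mat I c a * instr_mat I d b))"
        by (intro lincomb_add const lincomb_sum) auto
      then show ?thesis using d0 d coeff_take[OF _ _ e] const x(5) by (cases "p = q") simp_all
    qed
  qed
qed

end

text \<open>Initially all registers but 0, 1 and 2 are 0, so only nine coefficients of the form
  matter. The first nine entries of \<open>v\<close> are the products of two of the initial values
  1, \<open>x\<close>, \<open>y\<close>, and \<open>w\<close>, \<open>Ms\<close> depend on the
  program alone.\<close>

lemma regular_of_programmable:
  assumes k: "2 \<le> k" and R: "programmable R"
  obtains r w Ms where
    "\<And>v. length v = 9 + r \<Longrightarrow> valid_linrep k (v, w, Ms)"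
    "\<And>x y v. v = [1, x, y, x, x * x, x * y, y, y * x, y * y] @ replicate r 0 \<Longrightarrow>
      has_nontrivial_palindrome (linrep_seq k (map int v, w, Ms)) \<longleftrightarrow>
        (\<exists>s'. ((\<lambda>_. 0)(0 := 1, 1 := x, 2 := y), s') \<in> R)"
proof -
  obtain E p fin where E: "finite E" "E \<noteq> {}" "\<forall>(p, I, q)\<in>E. writable I" "R = path_rel E p fin"
    using R unfolding programmable_def by blast
  obtain es where set_es: "set es = E" using E(1) finite_list by blast
  obtain m0 where m0: "\<forall>(p, I, q)\<in>E. uses_below m0 I" using ex_uses_below[OF E(1)] by blast
  \<comment> \<open>The bound is raised so that the three initial registers lie below it.\<close>
  have "uses_below (m0 + 3) I" if "uses_below m0 I" for I using that by (cases I) auto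
  then obtain m where m_ge: "3 \<le> m" and m: "\<forall>(p, I, q)\<in>E. uses_below m I"
    using m0 by (intro that[of "m0 + 3"]) auto
  interpret penalty k m es fin
    by unfold_locales (use k E set_es m m_ge in auto)
  \<comment> \<open>The order of this list matches the order of the nine products in
    \<open>v\<close>.\<close>
  define P where "P = [psum (coeff p 0 a b). a \<leftarrow> [0..<3], b \<leftarrow> [0..<3]]"
  let ?L = "P @ coeff_seqs p @ map psum (coeff_seqs p)"
  define r where "r = length ?L - 9"
  have P: "P = [psum (coeff p 0 0 0), psum (coeff p 0 0 1), psum (coeff p 0 0 2),
      psum (coeff p 0 1 0), psum (coeff p 0 1 1), psum (coeff p 0 1 2),
      psum (coeff p 0 2 0), psum (coeff p 0 2 1), psum (coeff p 0 2 2)]"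
    by (simp add: P_def upt_conv_Cons numeral_3_eq_3 numeral_2_eq_2)
  have len: "length ?L = 9 + r" by (simp add: r_def P)
  have "set P \<subseteq> set (map psum (coeff_seqs p))"
  proof
    fix x assume "x \<in> set P"
    then obtain a b where "a < 3" "b < 3" "x = psum (coeff p 0 a b)" unfolding P_def by auto
    moreover have "coeff p 0 a b \<in> set (coeff_seqs p)" if "a < 3" "b < 3" for a b
    proof -
      have "p \<in> set (labels p)" "0 < length es" "a < m" "b < m"
        using that es m_ge by (auto simp: labels_def)
      then show ?thesis unfolding coeff_seqs_iff by blast
    qed
    ultimately show "x \<in> set (map psum (coeff_seqs p))" by simp
  qed
  then have "kernel_closed k ?L" by (rule kernel_closed_psum[OF kernel_closed_coeff_seqs])
  then obtain w Ms where w: "\<And>v. length v = length ?L \<Longrightarrow> valid_linrep k (v, w, Ms)"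
    "\<And>v n. length v = length ?L \<Longrightarrow> linrep_seq k (v, w, Ms) n = (\<Sum>i<length ?L. v ! i * (?L ! i) n)"
    by (rule linrep_of_kernel_closed[OF k]) blast
  show ?thesis
  proof (rule that)
    show "valid_linrep k (v, w, Ms)" if "length v = 9 + r" for v using w(1) that len by simp
    fix x y :: nat and v assume v: "v = [1, x, y, x, x * x, x * y, y, y * x, y * y] @ replicate r 0"
    let ?s = "(\<lambda>_. 0)(0 := 1, 1 := x, 2 := y) :: state"
    have "linrep_seq k (map int v, w, Ms) n = psum (cost p 0 ?s) n" for n
    proof -
      have "linrep_seq k (map int v, w, Ms) n = (\<Sum>i<9 + r. map int v ! i * (?L ! i) n)"
        using w(2)[of "map int v"] v unfolding len by simp
      also have "\<dots> = (\<Sum>i<9. map int v ! i * (?L ! i) n)"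
        by (rule sum.mono_neutral_right) (auto simp: v nth_append)
      also have "\<dots> = (\<Sum>a<3. \<Sum>b<3. psum (coeff p 0 a b) n * int (?s a) * int (?s b))"
        by (simp add: v P numeral_eq_Suc lessThan_Suc algebra_simps)
      \<comment> \<open>The added terms vanish because the registers from 3 on are 0.\<close>
      also have "\<dots> = (\<Sum>a<m. \<Sum>b<3. psum (coeff p 0 a b) n * int (?s a) * int (?s b))"
        by (rule sum.mono_neutral_left) (use m_ge in auto)
      also have "\<dots> = (\<Sum>a<m. \<Sum>b<m. psum (coeff p 0 a b) n * int (?s a) * int (?s b))"
        by (intro sum.cong refl sum.mono_neutral_left) (use m_ge in auto)
      also have "\<dots> = psum (cost p 0 ?s) n"
      proof -
        have "psum (cost p 0 ?s) n = (\<Sum>a<m. \<Sum>j<n. \<Sum>b<m. coeff p 0 a b j * int (?s a) * int (?s b))"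
          unfolding psum_def cost_def by (rule sum.swap)
        also have "\<dots> = (\<Sum>a<m. \<Sum>b<m. \<Sum>j<n. coeff p 0 a b j * int (?s a) * int (?s b))"
          by (intro sum.cong refl sum.swap)
        finally show ?thesis by (simp only: psum_def sum_distrib_right)
      qed
      finally show ?thesis .
    qed
    then have "linrep_seq k (map int v, w, Ms) = psum (cost p 0 ?s)" by blast
    moreover have s: "?s 0 = 1" by simp
    moreover have "0 < length es" using es by simp
    ultimately have "has_nontrivial_palindrome (linrep_seq k (map int v, w, Ms)) \<longleftrightarrow> (\<exists>n. cost p 0 ?s n = 0)"
      using palindrome_psum_iff[of "cost p 0 ?s"] cost_nonneg[of ?s 0 p] by metis
    also have "\<dots> \<longleftrightarrow> (\<exists>s'. ((p, ?s), (fin, s')) \<in> (step (set es))\<^sup>*)"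
      using path_of_cost_zero[where s = ?s, OF s \<open>0 < length es\<close>] cost_zero_of_path[where s = ?s, OF _ s] by blast
    also have "\<dots> \<longleftrightarrow> (\<exists>s'. (?s, s') \<in> R)"
      unfolding E(4) path_rel_def set_es by simp
    finally show "has_nontrivial_palindrome (linrep_seq k (map int v, w, Ms)) \<longleftrightarrow> (\<exists>s'. (?s, s') \<in> R)" .
  qed
qed

text \<open>The value of \<open>f\<close> is computed into register 3. Register 4 lies below the
  scratch bound 5 and keeps its initial 0, so the final \<open>Test 3 4\<close> lets a run end
  exactly if the value is 0.\<close>

lemma regular_of_recfn:
  assumes k: "2 \<le> k" and f: "recfn 2 f"
  obtains r w Ms where
    "\<And>v. length v = 9 + r \<Longrightarrow> valid_linrep k (v, w, Ms)"
    "\<And>x y v. v = [1, x, y, x, x * x, x * y, y, y * x, y * y] @ replicate r 0 \<Longrightarrow>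
      has_nontrivial_palindrome (linrep_seq k (map int v, w, Ms)) \<longleftrightarrow> f [x, y] = 0"
proof -
  obtain R where R: "programmable R" "\<And>s. s 0 = 1 \<Longrightarrow>
      ensures R s (\<lambda>s'. s' 3 = f (map s [1, 2]) \<and> same_except 5 3 s s')"
    by (rule computableE[OF recfn_computable[OF f], of "[1, 2]" 5 3]) auto
  let ?S = "R O instr_rel (Test 3 4)"
  have "(\<exists>s'. ((\<lambda>_. 0)(0 := 1, 1 := x, 2 := y), s') \<in> ?S) \<longleftrightarrow> f [x, y] = 0" for x y
  proof -
    let ?s = "(\<lambda>_. 0)(0 := 1, 1 := x, 2 := y) :: state"
    have "t 3 = f [x, y] \<and> t 4 = 0" if "(?s, t) \<in> R" for t
      using R(2)[of ?s] that unfolding ensures_def same_except_def by auto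
    moreover have "\<exists>t. (?s, t) \<in> R" using R(2)[of ?s] unfolding ensures_def by auto
    ultimately show ?thesis unfolding instr_rel_def by fastforce
  qed
  moreover have "programmable ?S" by (intro programmable_comp programmable_instr R) auto
  ultimately show ?thesis using regular_of_programmable[OF k] that by (metis (no_types, lifting))
qed

section \<open>The diagonal argument\<close>

text \<open>\<open>recfn\<close> also fixes the values on lists of the wrong length; here only lists
  of length \<open>n\<close> count.\<close>

definition recursive :: "nat \<Rightarrow> (nat list \<Rightarrow> nat) \<Rightarrow> bool" where
  "recursive n F \<longleftrightarrow> (\<exists>f. recfn n f \<and> (\<forall>xs. length xs = n \<longrightarrow> f xs = F xs))"

lemma recursive_recfn: "recfn n f \<Longrightarrow> recursive n f"
  unfolding recursive_def by blast

lemma recursive_proj: "i < n \<Longrightarrow> recursive n (\<lambda>xs. xs ! i)"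
  by (intro recursive_recfn rf_proj)

lemma recursive_comp1:
  assumes "recursive 1 h" "recursive n g"
  shows "recursive n (\<lambda>xs. h [g xs])"
proof -
  obtain h' g' where h': "recfn 1 h'" "\<forall>xs. length xs = 1 \<longrightarrow> h' xs = h xs"
    and g': "recfn n g'" "\<forall>xs. length xs = n \<longrightarrow> g' xs = g xs"
    using assms unfolding recursive_def by blast
  have "recfn n (\<lambda>xs. h' (map (\<lambda>g. g xs) [g']))" by (rule rf_comp[OF h'(1)]) (use g' in auto)
  then show ?thesis unfolding recursive_def using h' g' by (intro exI[of _ "\<lambda>xs. h' (map (\<lambda>g. g xs) [g'])"]) auto
qed

lemma recursive_comp2:
  assumes "recursive 2 h" "recursive n g1" "recursive n g2"
  shows "recursive n (\<lambda>xs. h [g1 xs, g2 xs])"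
proof -
  obtain h' f1 f2 where h': "recfn 2 h'" "\<forall>xs. length xs = 2 \<longrightarrow> h' xs = h xs"
    and f1: "recfn n f1" "\<forall>xs. length xs = n \<longrightarrow> f1 xs = g1 xs"
    and f2: "recfn n f2" "\<forall>xs. length xs = n \<longrightarrow> f2 xs = g2 xs"
    using assms unfolding recursive_def by blast
  have "recfn n (\<lambda>xs. h' (map (\<lambda>g. g xs) [f1, f2]))"
    by (rule rf_comp[OF h'(1)]) (use f1 f2 in \<open>auto simp: less_2_cases_iff\<close>)
  then show ?thesis unfolding recursive_def using h' f1 f2
    by (intro exI[of _ "\<lambda>xs. h' (map (\<lambda>g. g xs) [f1, f2])"]) auto
qed

lemma recursive_prim_rec:
  assumes "recursive n f" "recursive (Suc (Suc n)) g"
  shows "recursive (Suc n) (\<lambda>xs. rec_nat (f (tl xs)) (\<lambda>z acc. g (z # acc # tl xs)) (hd xs))"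
proof -
  obtain f' g' where f': "recfn n f'" "\<forall>xs. length xs = n \<longrightarrow> f' xs = f xs"
    and g': "recfn (Suc (Suc n)) g'" "\<forall>xs. length xs = Suc (Suc n) \<longrightarrow> g' xs = g xs"
    using assms unfolding recursive_def by blast
  have "prim_rec_fun f' g' xs = rec_nat (f (tl xs)) (\<lambda>z acc. g (z # acc # tl xs)) (hd xs)"
    if len: "length xs = Suc n" for xs
  proof -
    obtain y ys where ys: "xs = y # ys" "length ys = n" using len by (cases xs) auto
    have "f' ys = f ys" "(\<lambda>z acc. g' (z # acc # ys)) = (\<lambda>z acc. g (z # acc # ys))"
      using ys(2) f'(2) g'(2) by simp_all
    then show ?thesis by (simp add: prim_rec_fun_def ys(1))
  qed
  with rf_prec[OF f'(1) g'(1)] show ?thesis unfolding recursive_def by blast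
qed

lemma recursive_zero: "recursive n (\<lambda>_. 0)"
  by (intro recursive_recfn rf_zero)

lemma recursive_Suc: "recursive n g \<Longrightarrow> recursive n (\<lambda>xs. Suc (g xs))"
  using recursive_comp1[OF recursive_recfn[OF rf_succ]] by simp

lemma recursive_cong:
  assumes "recursive n f" "\<And>xs. length xs = n \<Longrightarrow> f xs = g xs"
  shows "recursive n g"
  using assms unfolding recursive_def by metis

lemma recursive_add: "recursive n f \<Longrightarrow> recursive n g \<Longrightarrow> recursive n (\<lambda>xs. f xs + g xs)"
proof -
  \<comment> \<open>In the step function, position 0 is the counter, position 1 the accumulator, and
    the parameter follows.\<close>
  have "recursive (Suc 1) (\<lambda>xs. rec_nat (tl xs ! 0) (\<lambda>z acc. Suc ((z # acc # tl xs) ! 1)) (hd xs))"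
    by (intro recursive_prim_rec recursive_Suc recursive_proj) auto
  moreover have "rec_nat x (\<lambda>z acc. Suc acc) y = y + x" for x y :: nat by (induction y) auto
  ultimately have "recursive 2 (\<lambda>xs. xs ! 0 + xs ! 1)"
    by (auto elim!: recursive_cong simp: numeral_2_eq_2 length_Suc_conv)
  from recursive_comp2[OF this] show "recursive n f \<Longrightarrow> recursive n g \<Longrightarrow> recursive n (\<lambda>xs. f xs + g xs)"
    by simp
qed

lemma recursive_mult: "recursive n f \<Longrightarrow> recursive n g \<Longrightarrow> recursive n (\<lambda>xs. f xs * g xs)"
proof -
  have "recursive (Suc 1) (\<lambda>xs. rec_nat 0 (\<lambda>z acc. (z # acc # tl xs) ! 1 + (z # acc # tl xs) ! 2) (hd xs))"
    by (intro recursive_prim_rec recursive_zero recursive_add recursive_proj) auto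
  moreover have "rec_nat 0 (\<lambda>z acc. acc + x) y = y * x" for x y :: nat by (induction y) auto
  ultimately have "recursive 2 (\<lambda>xs. xs ! 0 * xs ! 1)"
    by (auto elim!: recursive_cong simp: numeral_2_eq_2 length_Suc_conv)
  from recursive_comp2[OF this] show "recursive n f \<Longrightarrow> recursive n g \<Longrightarrow> recursive n (\<lambda>xs. f xs * g xs)"
    by simp
qed

text \<open>The pairing is the triangular number of the sum plus the first component, and triangular
  numbers satisfy a primitive recursion.\<close>

lemma recursive_prod_encode:
  assumes "recursive n f" "recursive n g"
  shows "recursive n (\<lambda>xs. prod_encode (f xs, g xs))"
proof -
  have "recursive (Suc 0) (\<lambda>xs. rec_nat 0 (\<lambda>z acc. (z # acc # tl xs) ! 1 + Suc ((z # acc # tl xs) ! 0)) (hd xs))"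
    by (intro recursive_prim_rec recursive_zero recursive_add recursive_Suc recursive_proj) auto
  moreover have "rec_nat 0 (\<lambda>z acc. acc + Suc z) y = triangle y" for y by (induction y) auto
  ultimately have "recursive 1 (\<lambda>xs. triangle (xs ! 0))"
    by (auto elim!: recursive_cong simp: length_Suc_conv)
  from recursive_comp1[OF this recursive_add[OF assms]] have "recursive n (\<lambda>xs. triangle (f xs + g xs))"
    by simp
  from recursive_add[OF this assms(1)] show ?thesis by (simp add: prod_encode_def)
qed

text \<open>\<open>int_encode\<close> sends a nonnegative integer to its double.\<close>

lemma enc_ints_Cons: "enc_ints (map int (x # xs)) = Suc (prod_encode (2 * x, enc_ints (map int xs)))"
  by (simp add: enc_ints_def int_encode_def sum_encode_def)

text \<open>Here \<open>x\<close> codes the zero padding of the row vector and \<open>y\<close> the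
  pair of column vector and matrices. The nine input entries, which are computed from these same
  numbers, are prepended to \<open>x\<close>.\<close>

definition instance_code :: "nat \<Rightarrow> nat \<Rightarrow> nat" where
  "instance_code x y = prod_encode
     (foldr (\<lambda>z c. Suc (prod_encode (2 * z, c))) [1, x, y, x, x * x, x * y, y, y * x, y * y] x, y)"

lemma recursive_instance_code: "recursive 2 (\<lambda>xs. instance_code (xs ! 0) (xs ! 1))"
  unfolding instance_code_def mult_2 One_nat_def foldr.simps o_apply id_apply
  by (intro recursive_prod_encode recursive_Suc recursive_add recursive_mult recursive_proj recursive_zero) auto

text \<open>The codes in the row vector describe only the other parts of the representation, so the
  self-reference needs no fixed point.\<close>

lemma enc_linrep_eq_instance_code:
  assumes "x = enc_ints (replicate r 0)"
    and "y = prod_encode (enc_ints w, list_encode (map (\<lambda>M. list_encode (map enc_ints M)) Ms))"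
    and "v = [1, x, y, x, x * x, x * y, y, y * x, y * y] @ replicate r 0"
  shows "enc_linrep (map int v, w, Ms) = instance_code x y"
  using assms(1) unfolding enc_linrep_def instance_code_def assms(2)[symmetric] assms(3)
  by (simp add: enc_ints_Cons flip: assms(2) list.map(2))

theorem theorem5p2:
  fixes k :: nat
  assumes "k \<ge> 2"
  shows "\<not> (\<exists>dec. recfn 1 dec \<and>
            (\<forall>R. valid_linrep k R \<longrightarrow>
               dec [enc_linrep R] =
                 (if has_nontrivial_palindrome (linrep_seq k R) then 1 else 0)))"
proof
  assume "\<exists>dec. recfn 1 dec \<and> (\<forall>R. valid_linrep k R \<longrightarrow>
      dec [enc_linrep R] = (if has_nontrivial_palindrome (linrep_seq k R) then 1 else 0))"
  then obtain dec where dec: "recfn 1 dec" "\<And>R. valid_linrep k R \<Longrightarrow>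
      dec [enc_linrep R] = (if has_nontrivial_palindrome (linrep_seq k R) then 1 else 0)" by blast
  \<comment> \<open>This function assembles the code of a representation from the codes of its parts
    and applies the decision procedure.\<close>
  obtain f where f: "recfn 2 f" "\<And>x y. f [x, y] = dec [instance_code x y]"
    using recursive_comp1[OF recursive_recfn[OF dec(1)] recursive_instance_code]
    unfolding recursive_def by force
  obtain r w Ms where R: "\<And>v. length v = 9 + r \<Longrightarrow> valid_linrep k (v, w, Ms)"
    "\<And>x y v. v = [1, x, y, x, x * x, x * y, y, y * x, y * y] @ replicate r 0 \<Longrightarrow>
      has_nontrivial_palindrome (linrep_seq k (map int v, w, Ms)) \<longleftrightarrow> f [x, y] = 0"
    by (rule regular_of_recfn[OF assms f(1)]) blast
  define x where "x = enc_ints (replicate r 0)"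
  define y where "y = prod_encode (enc_ints w, list_encode (map (\<lambda>M. list_encode (map enc_ints M)) Ms))"
  define v where "v = [1, x, y, x, x * x, x * y, y, y * x, y * y] @ replicate r 0"
  have "valid_linrep k (map int v, w, Ms)" by (rule R(1)) (simp add: v_def)
  \<comment> \<open>A palindrome exists iff \<open>f [x, y]\<close> is 0, that is, iff the decision
    procedure denies its existence for this very representation.\<close>
  from dec(2)[OF this] show False
    unfolding enc_linrep_eq_instance_code[OF x_def y_def v_def] R(2)[OF v_def] f(2)
    by (simp split: if_splits)
qed

end
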